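(* Let $k<N$ be positive integers. For any $p>0$ there exist nonnegative bounded viscosity solutions $u$ of $$\mathcal{P}^-_k(D^2u(x))+u^p(x)=0\quad\text{in }\mathbb{R}^N_+,\qquad u=0\quad\text{on }\partial\mathbb{R}^N_+,$$ such that $$\limsup_{x_N\to+\infty}u(x',x_N)>0\quad\text{uniformly with respect to }x'\in\mathbb{R}^{N-1},$$ i.e. such that there exist $c>0$ and a sequence $t_n\to+\infty$ with $u(x',t_n)\ge c$ for all $x'\in\mathbb{R}^{N-1}$ and all $n$.
   Context: $\mathbb{R}^N_+=\{x=(x',x_N)\in\mathbb{R}^{N-1}\times\mathbb{R}: x_N>0\}$. For a symmetric $N\times N$ real matrix $X$ with ordered eigenvalues $\lambda_1(X)\le\cdots\le\lambda_N(X)$, set $\mathcal{P}^-_k(X)=\sum_{i=1}^k\lambda_i(X)$. A nonnegative viscosity solution of the boundary value problem is a continuous function $u:\overline{\mathbb{R}^N_+}\to[0,+\infty)$ with $u=0$ on $\partial\mathbb{R}^N_+$ such that, for every $x_0\in\mathbb{R}^N_+$ and every $C^2$ function $\varphi$: if $u-\varphi$ has a local minimum at $x_0$, then $\mathcal{P}^-_k(D^2\varphi(x_0))+u(x_0)^p\le 0$; if $u-\varphi$ has a local maximum at $x_0$, then $\mathcal{P}^-_k(D^2\varphi(x_0))+u(x_0)^p\ge 0$. *)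

theory Defs
  imports "HOL-Analysis.Analysis" "HOL-Computational_Algebra.Polynomial"
begin

(* The "last" coordinate x_N is the one with index l; the remaining ones form x'. *)

definition half_space :: "'n::finite \<Rightarrow> (real ^ 'n) set" where
  "half_space l = {x. 0 < x $ l}"

definition charpoly :: "real ^ 'n ^ 'n \<Rightarrow> real poly" where
  "charpoly X = det (mat [:0, 1:] - map_matrix (\<lambda>a. [:a:]) X)"

(* Real eigenvalues in increasing order, repeated according to multiplicity. For symmetric X
   this list has length CARD('n), its entry with index i - 1 being lambda_i(X). *)
definition eigenvalues :: "real ^ 'n ^ 'n \<Rightarrow> real list" where
  "eigenvalues X = sorted_list_of_multiset (proots (charpoly X))"

definition P_minus :: "nat \<Rightarrow> real ^ 'n ^ 'n \<Rightarrow> real" where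
  "P_minus k X = (\<Sum>i<k. eigenvalues X ! i)"

(* For open S: f is twice continuously differentiable on S, with gradient G and Hessian H
   there (both are uniquely determined on S). *)
definition C2_with ::
  "(real ^ 'n) set \<Rightarrow> (real ^ 'n \<Rightarrow> real) \<Rightarrow> (real ^ 'n \<Rightarrow> real ^ 'n) \<Rightarrow> (real ^ 'n \<Rightarrow> real ^ 'n ^ 'n) \<Rightarrow> bool"
where
  "C2_with S f G H \<longleftrightarrow>
     (\<forall>x\<in>S. GDERIV f x :> G x) \<and>
     (\<forall>x\<in>S. (G has_derivative (\<lambda>h. H x *v h)) (at x)) \<and>
     continuous_on S H"

definition has_local_min :: "('a::topological_space \<Rightarrow> real) \<Rightarrow> 'a \<Rightarrow> bool" where
  "has_local_min f x \<longleftrightarrow> (\<forall>\<^sub>F y in nhds x. f x \<le> f y)"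

definition has_local_max :: "('a::topological_space \<Rightarrow> real) \<Rightarrow> 'a \<Rightarrow> bool" where
  "has_local_max f x \<longleftrightarrow> (\<forall>\<^sub>F y in nhds x. f y \<le> f x)"

(* Only the values of u on the closed half-space matter: every test point is interior to it. *)
definition nonneg_viscosity_solution ::
  "'n::finite \<Rightarrow> nat \<Rightarrow> real \<Rightarrow> (real ^ 'n \<Rightarrow> real) \<Rightarrow> bool"
where
  "nonneg_viscosity_solution l k p u \<longleftrightarrow>
     continuous_on (closure (half_space l)) u \<and>
     (\<forall>x\<in>closure (half_space l). 0 \<le> u x) \<and>
     (\<forall>x\<in>frontier (half_space l). u x = 0) \<and>
     (\<forall>x\<^sub>0\<in>half_space l. \<forall>\<phi> G H. C2_with (half_space l) \<phi> G H \<longrightarrow>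
        (has_local_min (\<lambda>x. u x - \<phi> x) x\<^sub>0 \<longrightarrow> P_minus k (H x\<^sub>0) + u x\<^sub>0 powr p \<le> 0) \<and>
        (has_local_max (\<lambda>x. u x - \<phi> x) x\<^sub>0 \<longrightarrow> P_minus k (H x\<^sub>0) + u x\<^sub>0 powr p \<ge> 0))"

end

theory Submission
  imports Defs
begin

text \<open>
  A function of \<open>x $ l\<close> alone, \<open>u x = v (x $ l)\<close>, has the Hessian eigenvalues \<open>v''\<close> and 0, the latter with
  multiplicity \<open>N - 1\<close>. Where \<open>v'' \<le> 0\<close>, the sum of the \<open>k < N\<close> lowest is \<open>v''\<close>, and the equation becomes
  \<open>v'' + v powr p = 0\<close>. Its positive solutions are concave bumps that reach 0 at both ends of a bounded
  interval. The solution below is a periodic row of bumps of height 1, glued at their zeros, with the first zero on the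
  boundary of the half-space. It is bounded, and its maxima recur on the planes \<open>x $ l = t n\<close>.

  The corners between two bumps are harmless because the operator is so degenerate. At a corner
  \<open>u\<close> is 0 on a whole hyperplane; a test function touching from below has a nonpositive Hessian on
  that hyperplane, so all but its largest eigenvalue are nonpositive, and the \<open>k < N\<close> lowest have a
  nonpositive sum. A test function touching from above has a minimum there, since \<open>u \<ge> 0\<close>, and the sum is
  nonnegative. This is \<open>planar_viscosity_solution\<close>.

  The bumps are explicit up to inverting a function of one variable (\<open>bump_angle_exists\<close>,
  \<open>periodic_profile_exists\<close>). The bounds on sums of lowest eigenvalues rest on an orthonormal basis of
  eigenvectors whose eigenvalues are the roots of the characteristic polynomial with multiplicity
  (\<open>symmetric_matrix_has_ordered_eigenbasis\<close>), and this applies to Hessians by \<open>hessian_symmetric\<close>.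
\<close>

section \<open>The spectral theorem for symmetric matrices\<close>

text \<open>
  A maximiser \<open>e\<close> of the quadratic form on the unit sphere of \<open>S\<close> is an eigenvector: with \<open>c\<close> the
  maximal value, \<open>c * (x \<bullet> x) - f x \<bullet> x\<close> is nonnegative on \<open>S\<close> and vanishes at \<open>e\<close>, so its
  first variation at \<open>e\<close> vanishes in every direction of \<open>S\<close>, in particular in the direction
  \<open>c *\<^sub>R e - f e\<close>.
\<close>

lemma self_adjoint_has_eigenvector_in_subspace:
  fixes f :: "'a::euclidean_space \<Rightarrow> 'a"
  assumes lin: "linear f" and sa: "\<And>x y. f x \<bullet> y = x \<bullet> f y"
    and S: "subspace S" and inv: "f ` S \<subseteq> S" and ne: "S \<noteq> {0}"
  obtains e c where "e \<in> S" "norm e = 1" "f e = c *\<^sub>R e"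
proof -
  obtain z where z: "z \<in> S" "z \<noteq> 0"
    using ne S subspace_0 by blast
  have "compact (sphere 0 1 \<inter> S)"
    using S closed_subspace by (intro compact_Int_closed) auto
  moreover have "z /\<^sub>R norm z \<in> sphere 0 1 \<inter> S"
    using z S by (simp add: subspace_scale)
  moreover have "continuous_on (sphere 0 1 \<inter> S) (\<lambda>x. f x \<bullet> x)"
    by (intro continuous_intros linear_continuous_on linear_conv_bounded_linear[THEN iffD1] lin)
  ultimately obtain e where e: "e \<in> sphere 0 1 \<inter> S"
    and max: "\<And>x. x \<in> sphere 0 1 \<inter> S \<Longrightarrow> f x \<bullet> x \<le> f e \<bullet> e"
    using continuous_attains_sup[of "sphere 0 1 \<inter> S" "\<lambda>x. f x \<bullet> x"] by blast
  define c where "c = f e \<bullet> e"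
  have bound: "f x \<bullet> x \<le> c * (x \<bullet> x)" if "x \<in> S" for x
  proof (cases "x = 0")
    case False
    have "f (x /\<^sub>R norm x) \<bullet> (x /\<^sub>R norm x) \<le> c"
      unfolding c_def using that S False by (intro max) (simp add: subspace_scale)
    then have "f x \<bullet> x / (norm x)\<^sup>2 \<le> c"
      by (simp add: linear_cmul[OF lin] power2_eq_square divide_simps split: if_splits)
    then show ?thesis
      using False by (simp add: power2_norm_eq_inner divide_le_eq)
  qed (simp add: linear_0[OF lin])
  define y where "y = c *\<^sub>R e - f e"
  define b where "b = y \<bullet> y"
  define d where "d = c * (y \<bullet> y) - f y \<bullet> y"
  have yS: "y \<in> S"
    unfolding y_def using e inv S by (intro subspace_diff subspace_scale) auto
  have ee: "e \<bullet> e = 1"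
    using e by (simp add: norm_eq_1)
  \<comment> \<open>nonnegativity of \<open>c * (x \<bullet> x) - f x \<bullet> x\<close> along the line \<open>e + t *\<^sub>R y\<close>\<close>
  have q: "0 \<le> 2 * t * b + t\<^sup>2 * d" for t
  proof -
    have "f (e + t *\<^sub>R y) \<bullet> (e + t *\<^sub>R y) \<le> c * ((e + t *\<^sub>R y) \<bullet> (e + t *\<^sub>R y))"
      using e yS S by (intro bound subspace_add subspace_scale) auto
    moreover have "f y \<bullet> e = f e \<bullet> y"
      using sa[of y e] by (simp add: inner_commute)
    then have "f (e + t *\<^sub>R y) \<bullet> (e + t *\<^sub>R y) = c + 2 * t * (f e \<bullet> y) + t\<^sup>2 * (f y \<bullet> y)"
      by (simp add: linear_add[OF lin] linear_cmul[OF lin] inner_add_left inner_add_right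
          c_def power2_eq_square algebra_simps)
    moreover have "(e + t *\<^sub>R y) \<bullet> (e + t *\<^sub>R y) = 1 + 2 * t * (e \<bullet> y) + t\<^sup>2 * (y \<bullet> y)"
      by (simp add: inner_add_left inner_add_right ee power2_eq_square inner_commute)
    moreover have b: "b = c * (e \<bullet> y) - f e \<bullet> y"
      by (simp add: b_def y_def inner_diff_left)
    moreover have "2 * t * b + t\<^sup>2 * d = c * (1 + 2 * t * (e \<bullet> y) + t\<^sup>2 * (y \<bullet> y))
        - (c + 2 * t * (f e \<bullet> y) + t\<^sup>2 * (f y \<bullet> y))"
      unfolding d_def b by (simp add: algebra_simps)
    ultimately show ?thesis by simp
  qed
  have "b = 0"
  proof (rule ccontr)
    assume "b \<noteq> 0"
    then have b: "0 < b" by (simp add: b_def)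
    \<comment> \<open>a step against the slope, short enough that the quadratic term cannot compensate\<close>
    define t where "t = - b / (\<bar>d\<bar> + 1)"
    have "2 * t * b + t\<^sup>2 * d = - (b\<^sup>2 / (\<bar>d\<bar> + 1)) * (2 - d / (\<bar>d\<bar> + 1))"
      by (simp add: t_def power2_eq_square right_diff_distrib)
    also have "\<dots> < 0"
    proof -
      have "d < 2 * (\<bar>d\<bar> + 1)" using abs_ge_self[of d] abs_ge_zero[of d] by argo
      then have "d / (\<bar>d\<bar> + 1) < 2" by (simp add: divide_less_eq)
      then show ?thesis using b by (simp add: mult_pos_pos add_nonneg_pos)
    qed
    finally show False using q[of t] by simp
  qed
  then have "f e = c *\<^sub>R e" by (simp add: b_def y_def)
  with e that show thesis by auto
qed

text \<open>
  The vectors of \<open>S\<close> orthogonal to one eigenvector form an invariant subspace of smaller dimension.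
\<close>

lemma self_adjoint_orthonormal_eigenbasis:
  fixes f :: "'a::euclidean_space \<Rightarrow> 'a"
  assumes lin: "linear f" and sa: "\<And>x y. f x \<bullet> y = x \<bullet> f y"
  shows "subspace S \<Longrightarrow> f ` S \<subseteq> S \<Longrightarrow>
    \<exists>B. finite B \<and> pairwise orthogonal B \<and> (\<forall>b\<in>B. norm b = 1) \<and> span B = S \<and> (\<forall>b\<in>B. \<exists>c. f b = c *\<^sub>R b)"
proof (induction "dim S" arbitrary: S rule: less_induct)
  case less
  note S = less.prems(1) and inv = less.prems(2)
  show ?case
  proof (cases "S = {0}")
    case True
    then show ?thesis by (intro exI[of _ "{}"]) auto
  next
    case False
    obtain e c where e: "e \<in> S" "norm e = 1" "f e = c *\<^sub>R e"
      using self_adjoint_has_eigenvector_in_subspace[OF lin sa S inv False] by blast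
    define T where "T = {x \<in> S. x \<bullet> e = 0}"
    have T: "subspace T"
      using S unfolding T_def subspace_def by (auto simp: inner_add_left)
    have invT: "f ` T \<subseteq> T"
      using inv by (auto simp: T_def sa e(3))
    have "e \<notin> T" using e(2) by (auto simp: T_def norm_eq_1)
    then have "T \<subset> S" using e(1) unfolding T_def by blast
    then have "span T \<subset> span S"
      using S T by (simp add: span_eq_iff[THEN iffD2])
    then have "dim T < dim S" by (rule dim_psubset)
    from less.hyps[OF this T invT] obtain B where B: "finite B" "pairwise orthogonal B"
      "\<forall>b\<in>B. norm b = 1" "span B = T" "\<forall>b\<in>B. \<exists>c. f b = c *\<^sub>R b" by blast
    have BT: "B \<subseteq> T" using B(4) span_superset by blast
    have "span (insert e B) = S"
    proof
      show "span (insert e B) \<subseteq> S"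
        using e(1) BT S by (intro span_minimal) (auto simp: T_def)
      show "S \<subseteq> span (insert e B)"
      proof
        fix x assume x: "x \<in> S"
        have "x - (x \<bullet> e) *\<^sub>R e \<in> T"
          using x e S by (auto simp: T_def inner_diff_left norm_eq_1 subspace_diff subspace_scale)
        then show "x \<in> span (insert e B)"
          unfolding span_insert using B(4) by auto
      qed
    qed
    moreover have "pairwise orthogonal (insert e B)"
      using B(2) BT by (auto simp: pairwise_insert orthogonal_def T_def inner_commute)
    ultimately show ?thesis
      using B e by (intro exI[of _ "insert e B"]) auto
  qed
qed

lemma matrix_diff_mult_distribs:
  fixes A B C :: "'a::ring_1^'n^'n"
  shows "(A - B) ** C = A ** C - B ** C" "A ** (B - C) = A ** B - A ** C"
  by (simp_all add: vec_eq_iff matrix_matrix_mult_def algebra_simps sum_subtractf)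

lemma scalar_mat_mult_commute:
  fixes A :: "'a::comm_semiring_1^'n^'n"
  shows "mat c ** A = A ** mat c"
  by (simp add: vec_eq_iff matrix_matrix_mult_def mat_def if_distrib[of "\<lambda>x. _ * x"]
      if_distrib[of "\<lambda>x. x * _"] mult.commute cong: if_cong)

lemma map_matrix_const_poly_mult:
  fixes A B :: "real^'n^'n"
  shows "map_matrix (\<lambda>a. [:a:]) (A ** B) = map_matrix (\<lambda>a. [:a:]) A ** map_matrix (\<lambda>a. [:a:]) B"
proof -
  have "[:sum g S:] = (\<Sum>i\<in>S. [:g i:])" for g :: "'n \<Rightarrow> real" and S
    by (induction S rule: infinite_finite_induct) (simp_all, metis add_pCons add_0)
  then show ?thesis
    by (simp add: vec_eq_iff matrix_matrix_mult_def map_matrix_def mult.commute)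
qed

text \<open>
  The matrix \<open>Q\<close> with columns \<open>e i\<close> satisfies \<open>A ** Q = Q ** D\<close> with \<open>D\<close> diagonal. This identity
  persists for matrices of constant polynomials, where \<open>det Q\<close> is a nonzero element of an integral
  domain and can be cancelled.
\<close>

lemma charpoly_eq_prod_of_eigenbasis:
  fixes A :: "real^'n^'n" and e :: "'n \<Rightarrow> real^'n"
  assumes on: "\<And>i j. e i \<bullet> e j = (if i = j then 1 else 0)"
    and ev: "\<And>i. A *v e i = d i *\<^sub>R e i"
  shows "charpoly A = (\<Prod>i\<in>UNIV. [:- d i, 1:])"
proof -
  let ?P = "map_matrix (\<lambda>a. [:a:]) :: real^'n^'n \<Rightarrow> real poly^'n^'n"
  define Q :: "real^'n^'n" where "Q = (\<chi> i j. e j $ i)"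
  define D :: "real^'n^'n" where "D = (\<chi> i j. if i = j then d i else 0)"
  have "transpose Q ** Q = mat 1"
    by (simp add: vec_eq_iff matrix_matrix_mult_def transpose_def Q_def mat_def on[unfolded inner_vec_def inner_real_def])
  then have "?P (transpose Q) ** ?P Q = ?P (mat 1)"
    by (simp flip: map_matrix_const_poly_mult)
  also have "?P (mat 1) = mat 1"
    by (simp add: vec_eq_iff map_matrix_def mat_def one_pCons)
  finally have "det (?P (transpose Q) ** ?P Q) = det (mat 1 :: real poly^'n^'n)"
    by (simp only:)
  then have "det (?P (transpose Q)) * det (?P Q) = 1"
    by (simp only: det_mul det_I)
  then have nz: "det (?P Q) \<noteq> 0" by auto
  have "A ** Q = Q ** D"
  proof -
    have "(A ** Q) $ i $ j = (Q ** D) $ i $ j" for i j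
      using arg_cong[OF ev[of j], of "\<lambda>v. v $ i"]
      by (simp add: matrix_matrix_mult_def matrix_vector_mult_def Q_def D_def if_distrib[of "\<lambda>x. _ * x"] cong: if_cong)
    then show ?thesis by (simp add: vec_eq_iff)
  qed
  then have PAQ: "?P A ** ?P Q = ?P Q ** ?P D"
    by (simp flip: map_matrix_const_poly_mult)
  have "(mat [:0, 1:] - ?P A) ** ?P Q = mat [:0, 1:] ** ?P Q - ?P A ** ?P Q"
    by (rule matrix_diff_mult_distribs)
  also have "\<dots> = ?P Q ** (mat [:0, 1:] - ?P D)"
    by (simp only: PAQ scalar_mat_mult_commute matrix_diff_mult_distribs)
  finally have "det ((mat [:0, 1:] - ?P A) ** ?P Q) = det (?P Q ** (mat [:0, 1:] - ?P D))"
    by (simp only:)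
  then have "charpoly A * det (?P Q) = det (?P Q) * det (mat [:0, 1:] - ?P D)"
    by (simp only: charpoly_def det_mul)
  then have "charpoly A = det (mat [:0, 1:] - ?P D)" using nz by simp
  also have "\<dots> = (\<Prod>i\<in>UNIV. (mat [:0, 1:] - ?P D) $ i $ i)"
    by (rule det_diagonal) (simp add: mat_def map_matrix_def D_def)
  also have "\<dots> = (\<Prod>i\<in>UNIV. [:- d i, 1:])"
    by (simp add: mat_def map_matrix_def D_def)
  finally show ?thesis .
qed

text \<open>
  The entries of the sorted list of roots of the characteristic polynomial, matched with an
  orthonormal basis of eigenvectors. The basis is indexed by numbers because the list is.
\<close>

locale ordered_eigenbasis =
  fixes A :: "real^'n^'n" and e :: "nat \<Rightarrow> real^'n"
  assumes length_eigenvalues: "length (eigenvalues A) = CARD('n)"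
    and sorted_eigenvalues: "sorted (eigenvalues A)"
    and orthonormal: "i < CARD('n) \<Longrightarrow> j < CARD('n) \<Longrightarrow> e i \<bullet> e j = (if i = j then 1 else 0)"
    and eigen: "i < CARD('n) \<Longrightarrow> A *v e i = (eigenvalues A ! i) *\<^sub>R e i"
    and expand: "x = (\<Sum>i<CARD('n). (x \<bullet> e i) *\<^sub>R e i)"
begin

lemma parseval: "x \<bullet> x = (\<Sum>i<CARD('n). (x \<bullet> e i)\<^sup>2)"
  using arg_cong[OF expand[of x], of "\<lambda>z. x \<bullet> z"] by (simp add: inner_sum_right power2_eq_square)

lemma quadratic_form: "x \<bullet> (A *v x) = (\<Sum>i<CARD('n). (eigenvalues A ! i) * (x \<bullet> e i)\<^sup>2)"
proof -
  have "A *v x = A *v (\<Sum>i<CARD('n). (x \<bullet> e i) *\<^sub>R e i)"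
    by (rule arg_cong[OF expand])
  also have "\<dots> = (\<Sum>i<CARD('n). (x \<bullet> e i) *\<^sub>R (A *v e i))"
    by (subst linear_sum[OF matrix_vector_mul_linear]) (simp add: matrix_vector_mult_scaleR)
  also have "\<dots> = (\<Sum>i<CARD('n). (x \<bullet> e i) *\<^sub>R (eigenvalues A ! i) *\<^sub>R e i)"
    using eigen by simp
  finally have "A *v x = (\<Sum>i<CARD('n). (x \<bullet> e i) *\<^sub>R (eigenvalues A ! i) *\<^sub>R e i)" .
  then show ?thesis
    by (simp add: inner_sum_right power2_eq_square mult_ac)
qed

lemma inner_axis_basis: "axis l 1 \<bullet> e i = e i $ l"
  by (simp add: inner_axis')

end

text \<open>
  By \<open>charpoly_eq_prod_of_eigenbasis\<close> the eigenvalues of an orthonormal eigenbasis are exactly the roots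
  of the characteristic polynomial with their multiplicities, so sorting the basis by eigenvalue
  produces the same list.
\<close>

lemma symmetric_matrix_has_ordered_eigenbasis:
  fixes A :: "real^'n^'n"
  assumes sym: "transpose A = A"
  shows "\<exists>e. ordered_eigenbasis A e"
proof -
  have sa: "(A *v x) \<bullet> y = x \<bullet> (A *v y)" for x y
    by (metis dot_lmul_matrix sym vector_transpose_matrix)
  obtain B where B: "finite B" "pairwise orthogonal B" "\<forall>b\<in>B. norm b = 1" "span B = UNIV"
      "\<forall>b\<in>B. \<exists>c. A *v b = c *\<^sub>R b"
    using self_adjoint_orthonormal_eigenbasis[OF matrix_vector_mul_linear sa subspace_UNIV] by auto
  have "independent B"
    using B by (intro pairwise_orthogonal_independent) auto
  then have cardB: "card B = CARD('n)"
    using B(4) by (metis dim_eq_card_independent dim_span dim_UNIV DIM_cart DIM_real mult.right_neutral)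
  then obtain e' :: "'n \<Rightarrow> real^'n" where e': "bij_betw e' UNIV B"
    using B(1) finite_same_card_bij[of "UNIV :: 'n set" B] by auto
  have e'B: "e' i \<in> B" for i using e' by (auto simp: bij_betw_def)
  have on: "e' i \<bullet> e' j = (if i = j then 1 else 0)" for i j
  proof (cases "i = j")
    case False
    then have "e' i \<noteq> e' j" using e' by (auto simp: bij_betw_def inj_on_def)
    then show ?thesis
      using False B(2) e'B by (auto simp: pairwise_def orthogonal_def)
  qed (use B(3) e'B in \<open>auto simp: norm_eq_1\<close>)
  have "\<forall>i. \<exists>c. A *v e' i = c *\<^sub>R e' i"
    using B(5) e'B by blast
  then obtain d where d: "\<And>i. A *v e' i = d i *\<^sub>R e' i"
    using choice[of "\<lambda>i c. A *v e' i = c *\<^sub>R e' i"] by blast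
  have roots: "proots (charpoly A) = image_mset d (mset_set UNIV)"
    unfolding charpoly_eq_prod_of_eigenbasis[OF on d]
    by (subst proots_prod) (auto simp: sum_unfold_sum_mset)
  obtain xs0 where xs0: "distinct xs0" "set xs0 = (UNIV :: 'n set)"
    using finite_distinct_list[of "UNIV :: 'n set"] by auto
  define xs where "xs = sort_key d xs0"
  have xs: "distinct xs" "set xs = UNIV" "sorted (map d xs)"
    using xs0 by (auto simp: xs_def)
  have len: "length xs = CARD('n)" using xs distinct_card by metis
  have "mset_set UNIV = mset xs" using xs mset_set_set by metis
  then have eig: "eigenvalues A = map d xs"
    unfolding eigenvalues_def roots using xs(3) by (simp add: sorted_sort_id flip: mset_map)
  define e where "e i = e' (xs ! i)" for i
  have bij: "bij_betw e {..<CARD('n)} B"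
    unfolding e_def using bij_betw_trans[OF bij_betw_nth[OF xs(1), of "{..<CARD('n)}" UNIV] e'] xs len
    by (auto simp: comp_def)
  show ?thesis
  proof (intro exI[of _ e] ordered_eigenbasis.intro)
    show "length (eigenvalues A) = CARD('n)" "sorted (eigenvalues A)" using xs len by (simp_all add: eig)
    show "e i \<bullet> e j = (if i = j then 1 else 0)" if "i < CARD('n)" "j < CARD('n)" for i j
      using that xs len by (simp add: e_def on nth_eq_iff_index_eq)
    show "A *v e i = (eigenvalues A ! i) *\<^sub>R e i" if "i < CARD('n)" for i
      using that len by (simp add: e_def eig d)
    show "x = (\<Sum>i<CARD('n). (x \<bullet> e i) *\<^sub>R e i)" for x
    proof -
      have "x = (\<Sum>b\<in>B. (x \<bullet> b) *\<^sub>R b)"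
        using B by (intro orthonormal_basis_expand[symmetric]) auto
      also have "\<dots> = (\<Sum>i<CARD('n). (x \<bullet> e i) *\<^sub>R e i)"
        by (rule sum.reindex_bij_betw[OF bij, symmetric])
      finally show ?thesis .
    qed
  qed
qed

section \<open>Bounds on sums of lowest eigenvalues\<close>

text \<open>
  Each eigenvalue is the value of the quadratic form at its unit eigenvector \<open>e i\<close>, hence at least
  \<open>\<mu> * (e i $ l)\<^sup>2\<close>. By Parseval the squares \<open>(e i $ l)\<^sup>2\<close> of any \<open>k\<close> basis vectors add up to at most 1.
\<close>

lemma le_P_minus_of_rank_one_lower_bound:
  fixes A :: "real^'n^'n"
  assumes sym: "transpose A = A" and k: "k \<le> CARD('n)" and \<mu>: "\<mu> \<le> 0"
    and lower: "\<And>x. \<mu> * (x $ l)\<^sup>2 \<le> x \<bullet> (A *v x)"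
  shows "\<mu> \<le> P_minus k A"
proof -
  obtain e where "ordered_eigenbasis A e"
    using symmetric_matrix_has_ordered_eigenbasis[OF sym] by (elim exE)
  then interpret ordered_eigenbasis A e .
  have one: "(\<Sum>i<CARD('n). (e i $ l)\<^sup>2) = 1"
    using parseval[of "axis l 1"] by (simp add: inner_axis_axis inner_axis_basis)
  have "(\<Sum>i<k. (e i $ l)\<^sup>2) \<le> (\<Sum>i<CARD('n). (e i $ l)\<^sup>2)"
    using k by (intro sum_mono2) auto
  then have "\<mu> \<le> (\<Sum>i<k. \<mu> * (e i $ l)\<^sup>2)"
    using \<mu> one mult_left_mono_neg[of "\<Sum>i<k. (e i $ l)\<^sup>2" 1 \<mu>] by (simp add: sum_distrib_left)
  also have "\<dots> \<le> (\<Sum>i<k. eigenvalues A ! i)"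
  proof (rule sum_mono)
    fix i assume "i \<in> {..<k}"
    then have "i < CARD('n)" using k by simp
    with lower[of "e i"] show "\<mu> * (e i $ l)\<^sup>2 \<le> eigenvalues A ! i"
      by (simp add: eigen orthonormal)
  qed
  finally show ?thesis by (simp add: P_minus_def)
qed

text \<open>
  An instance of Cauchy interlacing: two positive eigenvalues would make the form positive definite on
  the plane spanned by their eigenvectors, and every plane contains a nonzero vector of the hyperplane \<open>x $ l = 0\<close>.
\<close>

lemma eigenvalue_nonpos_of_hyperplane:
  fixes A :: "real^'n^'n"
  assumes sym: "transpose A = A" and i: "Suc i < CARD('n)"
    and upper: "\<And>x. x $ l = 0 \<Longrightarrow> x \<bullet> (A *v x) \<le> 0"
  shows "eigenvalues A ! i \<le> 0"
proof (rule ccontr)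
  assume neg: "\<not> eigenvalues A ! i \<le> 0"
  obtain e where "ordered_eigenbasis A e"
    using symmetric_matrix_has_ordered_eigenbasis[OF sym] by (elim exE)
  then interpret ordered_eigenbasis A e .
  have le: "eigenvalues A ! i \<le> eigenvalues A ! Suc i"
    using sorted_eigenvalues length_eigenvalues i by (intro sorted_nth_mono) auto
  have o: "e i \<bullet> e i = 1" "e (Suc i) \<bullet> e (Suc i) = 1" "e i \<bullet> e (Suc i) = 0" "e (Suc i) \<bullet> e i = 0"
    using i by (simp_all add: orthonormal)
  define a b where "a = e (Suc i) $ l" and "b = e i $ l"
  define x where "x = (if a = 0 then e (Suc i) else a *\<^sub>R e i - b *\<^sub>R e (Suc i))"
  have "x $ l = 0" by (simp add: x_def a_def b_def)
  then have "x \<bullet> (A *v x) \<le> 0" by (rule upper)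
  moreover have "0 < x \<bullet> (A *v x)"
  proof (cases "a = 0")
    case True
    then show ?thesis using neg le i by (simp add: x_def eigen o)
  next
    case False
    have "x \<bullet> (A *v x) = a\<^sup>2 * (eigenvalues A ! i) + b\<^sup>2 * (eigenvalues A ! Suc i)"
      using False i by (simp add: x_def eigen o matrix_vector_mult_diff_distrib matrix_vector_mult_scaleR
          inner_diff_left inner_diff_right power2_eq_square)
    also have "\<dots> > 0"
      using False neg le by (intro add_pos_nonneg mult_pos_pos mult_nonneg_nonneg) auto
    finally show ?thesis .
  qed
  ultimately show False by simp
qed

text \<open>
  The condition \<open>k < N\<close> enters here: the sum leaves out the largest eigenvalue, the only one that
  a form which is nonpositive on a hyperplane can have positive.
\<close>

lemma P_minus_nonpos_of_hyperplane:
  fixes A :: "real^'n^'n"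
  assumes sym: "transpose A = A" and k: "k < CARD('n)"
    and upper: "\<And>x. x $ l = 0 \<Longrightarrow> x \<bullet> (A *v x) \<le> 0"
  shows "P_minus k A \<le> 0"
  unfolding P_minus_def
proof (rule sum_nonpos)
  fix i assume "i \<in> {..<k}"
  then have "Suc i < CARD('n)" using k by simp
  then show "eigenvalues A ! i \<le> 0"
    by (rule eigenvalue_nonpos_of_hyperplane[where l = l, OF sym]) (rule upper)
qed

text \<open>
  The smallest eigenvalue is at most the value of the form at the unit normal of the hyperplane, and
  the remaining summands are nonpositive by interlacing.
\<close>

lemma P_minus_le_of_hyperplane:
  fixes A :: "real^'n^'n"
  assumes sym: "transpose A = A" and k: "0 < k" "k < CARD('n)"
    and upper: "\<And>x. x $ l = 0 \<Longrightarrow> x \<bullet> (A *v x) \<le> 0"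
    and normal: "axis l 1 \<bullet> (A *v axis l 1) \<le> \<mu>"
  shows "P_minus k A \<le> \<mu>"
proof -
  obtain e where "ordered_eigenbasis A e"
    using symmetric_matrix_has_ordered_eigenbasis[OF sym] by (elim exE)
  then interpret ordered_eigenbasis A e .
  let ?y = "axis l 1 :: real^'n"
  have one: "(\<Sum>i<CARD('n). (?y \<bullet> e i)\<^sup>2) = 1"
    using parseval[of ?y] by (simp add: inner_axis_axis)
  have "?y \<bullet> (A *v ?y) = (\<Sum>i<CARD('n). (eigenvalues A ! i) * (?y \<bullet> e i)\<^sup>2)"
    by (rule quadratic_form)
  also have "\<dots> \<ge> (\<Sum>i<CARD('n). (eigenvalues A ! 0) * (?y \<bullet> e i)\<^sup>2)"
    using length_eigenvalues sorted_eigenvalues by (intro sum_mono mult_right_mono sorted_nth_mono) auto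
  also have "(\<Sum>i<CARD('n). (eigenvalues A ! 0) * (?y \<bullet> e i)\<^sup>2) = eigenvalues A ! 0"
    by (simp add: one flip: sum_distrib_left)
  finally have "eigenvalues A ! 0 \<le> \<mu>"
    using normal by simp
  moreover have "(\<Sum>i\<in>{1..<k}. eigenvalues A ! i) \<le> 0"
  proof (rule sum_nonpos)
    fix i assume "i \<in> {1..<k}"
    then have "Suc i < CARD('n)" using k by simp
    then show "eigenvalues A ! i \<le> 0"
      by (rule eigenvalue_nonpos_of_hyperplane[where l = l, OF sym]) (rule upper)
  qed
  moreover have "P_minus k A = eigenvalues A ! 0 + (\<Sum>i\<in>{1..<k}. eigenvalues A ! i)"
    unfolding P_minus_def lessThan_atLeast0 using k(1) by (simp add: sum.atLeast_Suc_lessThan)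
  ultimately show ?thesis by linarith
qed

section \<open>Hessians and touching along lines\<close>

lemma gderiv_along_line:
  assumes "GDERIV f (y + s *\<^sub>R h) :> g"
  shows "((\<lambda>s. f (y + s *\<^sub>R h)) has_real_derivative h \<bullet> g) (at s)"
proof -
  have "((\<lambda>s. y + s *\<^sub>R h) has_derivative (\<lambda>t. t *\<^sub>R h)) (at s)"
    by (auto intro!: derivative_eq_intros)
  from has_derivative_compose[OF this assms[unfolded gderiv_def]]
  show ?thesis
    by (simp add: has_field_derivative_def mult_commute_abs)
qed

text \<open>
  The second difference is the increment over \<open>[0, t]\<close> of \<open>p s = f (x + t k + s h) - f (x + s h)\<close>. The
  mean value theorem turns it into \<open>t\<close> times a difference of two gradients at points within
  \<open>O(t)\<close> of \<open>x\<close>, and differentiability of \<open>G\<close> at \<open>x\<close> evaluates that difference up to \<open>o(t)\<close>.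
\<close>

lemma second_difference_estimate:
  fixes f :: "real^'n \<Rightarrow> real" and G :: "real^'n \<Rightarrow> real^'n"
  assumes S: "open S" "x \<in> S"
    and f: "\<And>y. y \<in> S \<Longrightarrow> GDERIV f y :> G y"
    and G: "(G has_derivative (\<lambda>h. H *v h)) (at x)"
    and \<epsilon>: "0 < \<epsilon>"
  shows "\<exists>d>0. \<forall>t. 0 < t \<and> t < d \<longrightarrow>
    \<bar>f (x + t *\<^sub>R h + t *\<^sub>R k) - f (x + t *\<^sub>R h) - f (x + t *\<^sub>R k) + f x - t\<^sup>2 * (h \<bullet> (H *v k))\<bar> \<le> \<epsilon> * t\<^sup>2"
proof -
  define C where "C = norm h + norm k + 1"
  have C: "0 < C" "norm h \<le> C" "norm h + norm k \<le> C"
    by (simp_all add: C_def add_nonneg_pos)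
  define \<eta> where "\<eta> = \<epsilon> / (2 * C * C)"
  have \<eta>: "0 < \<eta>" using \<epsilon> C by (simp add: \<eta>_def)
  obtain r where r: "0 < r" "ball x r \<subseteq> S"
    using S openE by blast
  obtain \<delta> where \<delta>: "0 < \<delta>"
    "\<And>y. norm (y - x) < \<delta> \<Longrightarrow> norm (G y - G x - H *v (y - x)) \<le> \<eta> * norm (y - x)"
    using G \<eta> unfolding has_derivative_at_alt by blast
  define d where "d = min r \<delta> / C"
  have "0 < d" using r \<delta> C by (simp add: d_def)
  moreover have "\<bar>f (x + t *\<^sub>R h + t *\<^sub>R k) - f (x + t *\<^sub>R h) - f (x + t *\<^sub>R k) + f x - t\<^sup>2 * (h \<bullet> (H *v k))\<bar> \<le> \<epsilon> * t\<^sup>2"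
    if t: "0 < t" "t < d" for t
  proof -
    have tC: "t * C < r" "t * C < \<delta>"
      using t C by (simp_all add: d_def less_divide_eq)
    have small: "norm (s *\<^sub>R h) \<le> t * C" "norm (s *\<^sub>R h + t *\<^sub>R k) \<le> t * C" if "0 \<le> s" "s \<le> t" for s
    proof -
      have "norm (s *\<^sub>R h) \<le> t * norm h"
        using that by (simp add: mult_right_mono)
      then show "norm (s *\<^sub>R h) \<le> t * C"
        using C t by (meson mult_left_mono less_imp_le order_trans)
      have "norm (s *\<^sub>R h + t *\<^sub>R k) \<le> s * norm h + t * norm k"
        using that t norm_triangle_ineq[of "s *\<^sub>R h" "t *\<^sub>R k"] by simp
      also have "\<dots> \<le> t * norm h + t * norm k"
        using that by (simp add: mult_right_mono)
      also have "\<dots> \<le> t * C"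
        using C t by (simp flip: distrib_left)
      finally show "norm (s *\<^sub>R h + t *\<^sub>R k) \<le> t * C" .
    qed
    define p where "p s = f ((x + t *\<^sub>R k) + s *\<^sub>R h) - f (x + s *\<^sub>R h)" for s
    have "(p has_real_derivative h \<bullet> G ((x + t *\<^sub>R k) + s *\<^sub>R h) - h \<bullet> G (x + s *\<^sub>R h)) (at s)"
      if s: "0 \<le> s" "s \<le> t" for s
    proof -
      have "(x + t *\<^sub>R k) + s *\<^sub>R h \<in> S" "x + s *\<^sub>R h \<in> S"
        using small[OF s] tC r(2) by (auto simp: dist_norm subset_iff norm_minus_commute add.assoc add.commute)
      then show ?thesis
        unfolding p_def by (intro derivative_intros gderiv_along_line f)
    qed
    then obtain s where s: "0 < s" "s < t"
      "p t - p 0 = (t - 0) * (h \<bullet> G ((x + t *\<^sub>R k) + s *\<^sub>R h) - h \<bullet> G (x + s *\<^sub>R h))"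
      using MVT2[OF t(1), of p "\<lambda>s. h \<bullet> G ((x + t *\<^sub>R k) + s *\<^sub>R h) - h \<bullet> G (x + s *\<^sub>R h)"] by blast
    define a where "a = s *\<^sub>R h + t *\<^sub>R k"
    define b where "b = s *\<^sub>R h"
    define Ra where "Ra = G (x + a) - G x - H *v a"
    define Rb where "Rb = G (x + b) - G x - H *v b"
    have nab: "norm a \<le> t * C" "norm b \<le> t * C"
      using small[of s] s by (simp_all add: a_def b_def)
    have "norm Ra \<le> \<eta> * norm a" "norm Rb \<le> \<eta> * norm b"
      unfolding Ra_def Rb_def using \<delta>(2)[of "x + a"] \<delta>(2)[of "x + b"] nab tC by simp_all
    then have R: "norm Ra \<le> \<eta> * (t * C)" "norm Rb \<le> \<eta> * (t * C)"
      using nab \<eta> by (meson mult_left_mono less_imp_le order_trans)+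
    have "H *v a - H *v b = t *\<^sub>R (H *v k)"
      by (simp add: a_def b_def matrix_vector_right_distrib matrix_vector_mult_scaleR)
    then have "G (x + a) - G (x + b) = t *\<^sub>R (H *v k) + (Ra - Rb)"
      by (simp add: Ra_def Rb_def algebra_simps)
    then have "h \<bullet> G (x + a) - h \<bullet> G (x + b) = t * (h \<bullet> (H *v k)) + h \<bullet> (Ra - Rb)"
      by (simp flip: inner_diff_right) (simp add: inner_add_right)
    moreover have "f (x + t *\<^sub>R h + t *\<^sub>R k) - f (x + t *\<^sub>R h) - f (x + t *\<^sub>R k) + f x = p t - p 0"
      by (simp add: p_def algebra_simps)
    moreover have "x + t *\<^sub>R k + s *\<^sub>R h = x + a" "x + s *\<^sub>R h = x + b"
      by (simp_all add: a_def b_def)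
    ultimately have "f (x + t *\<^sub>R h + t *\<^sub>R k) - f (x + t *\<^sub>R h) - f (x + t *\<^sub>R k) + f x - t\<^sup>2 * (h \<bullet> (H *v k))
        = t * (h \<bullet> (Ra - Rb))"
      using s(3) by (simp add: power2_eq_square distrib_left)
    also have "\<bar>\<dots>\<bar> = t * \<bar>h \<bullet> (Ra - Rb)\<bar>"
      using t by (simp add: abs_mult)
    also have "\<dots> \<le> t * (C * (2 * (\<eta> * (t * C))))"
    proof (rule mult_left_mono)
      have "\<bar>h \<bullet> (Ra - Rb)\<bar> \<le> norm h * norm (Ra - Rb)"
        by (rule Cauchy_Schwarz_ineq2)
      also have "\<dots> \<le> C * (2 * (\<eta> * (t * C)))"
        using C R norm_triangle_ineq4[of Ra Rb] by (intro mult_mono) auto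
      finally show "\<bar>h \<bullet> (Ra - Rb)\<bar> \<le> C * (2 * (\<eta> * (t * C)))" .
    qed (use t in simp)
    also have "\<dots> = \<epsilon> * t\<^sup>2"
      using C by (simp add: \<eta>_def power2_eq_square)
    finally show ?thesis .
  qed
  ultimately show ?thesis by blast
qed

text \<open>
  The second difference is symmetric in the two directions, hence so is its limit after division
  by \<open>t\<^sup>2\<close>.
\<close>

lemma hessian_symmetric:
  fixes f :: "real^'n \<Rightarrow> real" and G :: "real^'n \<Rightarrow> real^'n"
  assumes S: "open S" "x \<in> S"
    and f: "\<And>y. y \<in> S \<Longrightarrow> GDERIV f y :> G y"
    and G: "(G has_derivative (\<lambda>h. H *v h)) (at x)"
  shows "transpose H = H"
proof -
  have sym: "h \<bullet> (H *v k) = k \<bullet> (H *v h)" for h k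
  proof (rule ccontr)
    assume neq: "h \<bullet> (H *v k) \<noteq> k \<bullet> (H *v h)"
    define \<epsilon> where "\<epsilon> = \<bar>h \<bullet> (H *v k) - k \<bullet> (H *v h)\<bar> / 3"
    have \<epsilon>: "0 < \<epsilon>" using neq by (simp add: \<epsilon>_def)
    obtain d1 where d1: "0 < d1" "\<And>t. 0 < t \<Longrightarrow> t < d1 \<Longrightarrow>
      \<bar>f (x + t *\<^sub>R h + t *\<^sub>R k) - f (x + t *\<^sub>R h) - f (x + t *\<^sub>R k) + f x - t\<^sup>2 * (h \<bullet> (H *v k))\<bar> \<le> \<epsilon> * t\<^sup>2"
      using second_difference_estimate[OF S f G \<epsilon>] by metis
    obtain d2 where d2: "0 < d2" "\<And>t. 0 < t \<Longrightarrow> t < d2 \<Longrightarrow>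
      \<bar>f (x + t *\<^sub>R k + t *\<^sub>R h) - f (x + t *\<^sub>R k) - f (x + t *\<^sub>R h) + f x - t\<^sup>2 * (k \<bullet> (H *v h))\<bar> \<le> \<epsilon> * t\<^sup>2"
      using second_difference_estimate[OF S f G \<epsilon>] by metis
    define t where "t = min d1 d2 / 2"
    have t: "0 < t" "t < d1" "t < d2" using d1(1) d2(1) by (auto simp: t_def)
    define D where "D = f (x + t *\<^sub>R h + t *\<^sub>R k) - f (x + t *\<^sub>R h) - f (x + t *\<^sub>R k) + f x"
    have "f (x + t *\<^sub>R k + t *\<^sub>R h) - f (x + t *\<^sub>R k) - f (x + t *\<^sub>R h) + f x = D"
      by (simp add: D_def add.assoc add.commute[of "t *\<^sub>R k"])
    then have "\<bar>D - t\<^sup>2 * (h \<bullet> (H *v k))\<bar> \<le> \<epsilon> * t\<^sup>2" "\<bar>D - t\<^sup>2 * (k \<bullet> (H *v h))\<bar> \<le> \<epsilon> * t\<^sup>2"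
      using d1(2)[OF t(1,2)] d2(2)[OF t(1,3)] by (simp_all add: D_def)
    then have "\<bar>t\<^sup>2 * (h \<bullet> (H *v k)) - t\<^sup>2 * (k \<bullet> (H *v h))\<bar> \<le> 2 * (\<epsilon> * t\<^sup>2)"
      unfolding abs_le_iff by linarith
    then have "\<bar>t\<^sup>2 * (h \<bullet> (H *v k) - k \<bullet> (H *v h))\<bar> \<le> t\<^sup>2 * (2 * \<epsilon>)"
      by (simp add: algebra_simps)
    then have "t\<^sup>2 * \<bar>h \<bullet> (H *v k) - k \<bullet> (H *v h)\<bar> \<le> t\<^sup>2 * (2 * \<epsilon>)"
      by (simp add: abs_mult)
    then have "\<bar>h \<bullet> (H *v k) - k \<bullet> (H *v h)\<bar> \<le> 2 * \<epsilon>"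
      using t(1) by simp
    then show False using \<epsilon> by (simp add: \<epsilon>_def)
  qed
  have "H $ i $ j = H $ j $ i" for i j
    using sym[of "axis i 1" "axis j 1"]
    by (simp add: inner_axis' matrix_vector_mult_basis column_def)
  then show ?thesis by (simp add: vec_eq_iff transpose_def)
qed

lemma second_derivative_nonneg_at_local_min:
  fixes g :: "real \<Rightarrow> real"
  assumes min: "\<forall>\<^sub>F s in nhds t. g t \<le> g s"
    and g: "\<forall>\<^sub>F s in nhds t. (g has_real_derivative g' s) (at s)"
    and g': "(g' has_real_derivative c) (at t)"
  shows "0 \<le> c"
proof (rule ccontr)
  assume c: "\<not> 0 \<le> c"
  obtain d where d: "0 < d" "\<And>s. \<bar>s - t\<bar> < d \<Longrightarrow> g t \<le> g s \<and> (g has_real_derivative g' s) (at s)"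
    using eventually_conj[OF min g] unfolding eventually_nhds_metric dist_real_def by auto
  have "(g has_real_derivative g' t) (at t)" using d by simp
  then have "g' t = 0"
    by (rule DERIV_local_min[OF _ d(1)]) (use d(2) in \<open>simp add: abs_minus_commute\<close>)
  moreover obtain d' where d': "0 < d'" "\<And>h. 0 < h \<Longrightarrow> h < d' \<Longrightarrow> g' (t + h) < g' t"
    using DERIV_neg_dec_right[OF g'] c by auto
  moreover define h where "h = min d d' / 2"
  ultimately have h: "0 < h" "h < d" "h < d'" using d(1) by (auto simp: h_def)
  then have "\<And>s. t \<le> s \<Longrightarrow> s \<le> t + h \<Longrightarrow> (g has_real_derivative g' s) (at s)"
    using d(2) by simp
  then obtain s where s: "t < s" "s < t + h" "g (t + h) - g t = (t + h - t) * g' s"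
    using MVT2[of t "t + h" g g'] h(1) by auto
  have "g' s < 0"
    using d'(2)[of "s - t"] s(1,2) h \<open>g' t = 0\<close> by simp
  then have "g (t + h) < g t"
    using s(3) h(1) mult_pos_neg[of h "g' s"] by simp
  then show False using d(2)[of "t + h"] h by simp
qed

lemma line_second_derivatives:
  assumes C2: "C2_with S \<phi> G H" and S: "open S" "x \<in> S"
  shows "\<forall>\<^sub>F t in nhds 0. ((\<lambda>t. \<phi> (x + t *\<^sub>R h)) has_real_derivative h \<bullet> G (x + t *\<^sub>R h)) (at t)"
    and "((\<lambda>t. h \<bullet> G (x + t *\<^sub>R h)) has_real_derivative h \<bullet> (H x *v h)) (at 0)"
proof -
  have "((\<lambda>t. x + t *\<^sub>R h) \<longlongrightarrow> x + 0 *\<^sub>R h) (nhds 0)"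
    by (intro tendsto_intros filterlim_ident)
  then have "\<forall>\<^sub>F t in nhds 0. x + t *\<^sub>R h \<in> S"
    using S by (intro topological_tendstoD) auto
  then show "\<forall>\<^sub>F t in nhds 0. ((\<lambda>t. \<phi> (x + t *\<^sub>R h)) has_real_derivative h \<bullet> G (x + t *\<^sub>R h)) (at t)"
    by eventually_elim (use C2 in \<open>auto simp: C2_with_def intro!: gderiv_along_line\<close>)
  have line: "((\<lambda>t. x + t *\<^sub>R h) has_derivative (\<lambda>t. t *\<^sub>R h)) (at 0)"
    by (auto intro!: derivative_eq_intros)
  have "(G has_derivative (\<lambda>h. H x *v h)) (at (x + 0 *\<^sub>R h))"
    using C2 S by (simp add: C2_with_def)
  from has_derivative_inner_right[OF has_derivative_compose[OF line this], of h]
  show "((\<lambda>t. h \<bullet> G (x + t *\<^sub>R h)) has_real_derivative h \<bullet> (H x *v h)) (at 0)"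
    by (simp add: has_field_derivative_def matrix_vector_mult_scaleR mult_commute_abs)
qed

text \<open>
  Touching is only tested along lines: it compares the second derivative \<open>c\<close> of a function \<open>\<psi>\<close> of one
  variable with the Hessian of \<open>\<phi>\<close> in the direction \<open>h\<close>.
\<close>

lemma hessian_bounds_on_line:
  assumes C2: "C2_with S \<phi> G H" and S: "open S" "x \<in> S"
    and \<psi>: "\<forall>\<^sub>F t in nhds 0. (\<psi> has_real_derivative \<psi>' t) (at t)" "(\<psi>' has_real_derivative c) (at 0)"
  shows "\<forall>\<^sub>F t in nhds 0. \<psi> 0 - \<phi> x \<le> \<psi> t - \<phi> (x + t *\<^sub>R h) \<Longrightarrow> h \<bullet> (H x *v h) \<le> c"
    and "\<forall>\<^sub>F t in nhds 0. \<psi> t - \<phi> (x + t *\<^sub>R h) \<le> \<psi> 0 - \<phi> x \<Longrightarrow> c \<le> h \<bullet> (H x *v h)"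
proof -
  note line = line_second_derivatives[OF C2 S, of h]
  {
    assume min: "\<forall>\<^sub>F t in nhds 0. \<psi> 0 - \<phi> x \<le> \<psi> t - \<phi> (x + t *\<^sub>R h)"
    have "0 \<le> c - h \<bullet> (H x *v h)"
    proof (rule second_derivative_nonneg_at_local_min)
      show "\<forall>\<^sub>F t in nhds 0. \<psi> 0 - \<phi> (x + 0 *\<^sub>R h) \<le> \<psi> t - \<phi> (x + t *\<^sub>R h)"
        using min by simp
      show "\<forall>\<^sub>F t in nhds 0. ((\<lambda>t. \<psi> t - \<phi> (x + t *\<^sub>R h)) has_real_derivative \<psi>' t - h \<bullet> G (x + t *\<^sub>R h)) (at t)"
        using \<psi>(1) line(1) by eventually_elim (rule DERIV_diff)
      show "((\<lambda>t. \<psi>' t - h \<bullet> G (x + t *\<^sub>R h)) has_real_derivative c - h \<bullet> (H x *v h)) (at 0)"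
        using \<psi>(2) line(2) by (rule DERIV_diff)
    qed
    then show "h \<bullet> (H x *v h) \<le> c" by simp
  next
    assume max: "\<forall>\<^sub>F t in nhds 0. \<psi> t - \<phi> (x + t *\<^sub>R h) \<le> \<psi> 0 - \<phi> x"
    have "0 \<le> h \<bullet> (H x *v h) - c"
    proof (rule second_derivative_nonneg_at_local_min)
      show "\<forall>\<^sub>F t in nhds 0. \<phi> (x + 0 *\<^sub>R h) - \<psi> 0 \<le> \<phi> (x + t *\<^sub>R h) - \<psi> t"
        using max by eventually_elim simp
      show "\<forall>\<^sub>F t in nhds 0. ((\<lambda>t. \<phi> (x + t *\<^sub>R h) - \<psi> t) has_real_derivative h \<bullet> G (x + t *\<^sub>R h) - \<psi>' t) (at t)"
        using \<psi>(1) line(1) by eventually_elim (rule DERIV_diff)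
      show "((\<lambda>t. h \<bullet> G (x + t *\<^sub>R h) - \<psi>' t) has_real_derivative h \<bullet> (H x *v h) - c) (at 0)"
        using line(2) \<psi>(2) by (rule DERIV_diff)
    qed
    then show "c \<le> h \<bullet> (H x *v h)" by simp
  }
qed

section \<open>A periodic profile\<close>

text \<open>
  With \<open>a = 2 / (p + 1)\<close> the first integral of \<open>f'' = - f powr p\<close> suggests the substitution
  \<open>f = sin \<theta> powr a\<close>, which turns the equation into \<open>\<theta>' = sin \<theta> powr (1 - a) / sqrt a\<close>. Its solution is the
  inverse of \<open>X \<theta> = sqrt a * \<integral> sin powr (a - 1)\<close>. For \<open>a < 1\<close> this integrand is singular at 0 and \<open>\<pi>\<close>;
  integration by parts, using \<open>sin\<^sup>2 + cos\<^sup>2 = 1\<close>, gives a formula for \<open>X\<close> whose integrand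
  \<open>sin powr (a + 1)\<close> is continuous on \<open>[0, \<pi>]\<close>.
\<close>

lemma bump_angle_exists:
  fixes a :: real
  assumes a: "0 < a"
  shows "\<exists>\<theta> L t. 0 < t \<and> t < L \<and> continuous_on {0..L} \<theta> \<and> \<theta> 0 = 0 \<and> \<theta> L = pi \<and> \<theta> t = pi / 2 \<and>
    (\<forall>y. 0 < y \<and> y < L \<longrightarrow> 0 < \<theta> y \<and> \<theta> y < pi \<and>
       (\<theta> has_real_derivative sin (\<theta> y) powr (1 - a) / sqrt a) (at y))"
proof -
  define J where "J x = integral {0..x} (\<lambda>t. sin t powr (a + 1))" for x :: real
  define X where "X x = sqrt a * (sin x powr a * cos x / a + (1 + 1 / a) * J x)" for x
  have cont_pow: "continuous_on {0..pi} (\<lambda>t. sin t powr b)" if "0 < b" for b :: real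
    using that by (intro continuous_on_powr' continuous_intros) (auto simp: sin_ge_zero)
  have "continuous_on {0..pi} J"
    unfolding J_def using a by (intro indefinite_integral_continuous_1 integrable_continuous_real cont_pow) simp
  then have contX: "continuous_on {0..pi} X"
    unfolding X_def using a by (intro continuous_intros cont_pow) auto
  have derX: "(X has_real_derivative sqrt a * sin x powr (a - 1)) (at x)" if x: "0 < x" "x < pi" for x
  proof -
    have s: "0 < sin x" using x by (rule sin_gt_zero)
    have "(J has_real_derivative sin x powr (a + 1)) (at x within {0..pi})"
      unfolding J_def using a x by (intro integral_has_real_derivative cont_pow) auto
    then have J: "(J has_real_derivative sin x powr (a + 1)) (at x)"
      using x by (simp add: at_within_Icc_at)
    have P: "((\<lambda>x. sin x powr a) has_real_derivative a * sin x powr (a - 1) * cos x) (at x)"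
      using s by (auto intro!: derivative_eq_intros)
    define q where "q = sin x powr (a - 1)"
    have "sin x powr a = q * sin x" "sin x powr (a + 1) = q * (sin x)\<^sup>2"
      using s by (simp_all add: q_def powr_diff powr_add power2_eq_square)
    moreover have "(X has_real_derivative sqrt a *
        ((a * q * cos x * cos x + (- sin x) * sin x powr a) / a
          + (1 + 1 / a) * sin x powr (a + 1))) (at x)"
      unfolding X_def q_def
      by (intro DERIV_cmult DERIV_add DERIV_cdivide DERIV_mult DERIV_cos P J)
    moreover have "(a * q * c * c + (- s) * (q * s)) / a + (1 + 1 / a) * (q * s\<^sup>2) = q * (c\<^sup>2 + s\<^sup>2)"
      for c s :: real
      using a by (simp add: field_simps power2_eq_square)
    ultimately show ?thesis
      by (simp add: q_def)
  qed
  have incr: "X x < X y" if "0 \<le> x" "x < y" "y \<le> pi" for x y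
  proof (rule DERIV_pos_imp_increasing_open[OF that(2)])
    show "\<exists>D. (X has_real_derivative D) (at z) \<and> 0 < D" if "x < z" "z < y" for z
    proof (intro exI conjI)
      have z: "0 < z" "z < pi" using that \<open>0 \<le> x\<close> \<open>y \<le> pi\<close> by auto
      show "(X has_real_derivative sqrt a * sin z powr (a - 1)) (at z)" by (rule derX[OF z])
      show "0 < sqrt a * sin z powr (a - 1)" using a sin_gt_zero[OF z] by simp
    qed
    show "continuous_on {x..y} X"
      using that by (intro continuous_on_subset[OF contX]) auto
  qed
  have inj: "inj_on X {0..pi}"
    by (rule linorder_inj_onI) (use incr in force)+
  define \<theta> where "\<theta> = inv_into {0..pi} X"
  define L where "L = X pi"
  have X0: "X 0 = 0" by (simp add: X_def J_def)
  have image: "X ` {0..pi} = {0..L}"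
  proof
    show "X ` {0..pi} \<subseteq> {0..L}"
    proof (clarsimp simp: L_def)
      fix x assume "0 \<le> x" "x \<le> pi"
      then show "0 \<le> X x \<and> X x \<le> X pi"
        using incr[of 0 x] incr[of x pi] X0 by (cases "x = 0"; cases "x = pi") auto
    qed
    show "{0..L} \<subseteq> X ` {0..pi}"
    proof
      fix y assume "y \<in> {0..L}"
      then obtain x where "0 \<le> x" "x \<le> pi" "X x = y"
        using IVT'[of X 0 y pi] contX X0 by (auto simp: L_def)
      then show "y \<in> X ` {0..pi}" by auto
    qed
  qed
  have \<theta>X: "\<theta> (X x) = x" if "0 \<le> x" "x \<le> pi" for x
    unfolding \<theta>_def using inj that by (intro inv_into_f_f) auto
  have X\<theta>: "X (\<theta> y) = y" "0 \<le> \<theta> y" "\<theta> y \<le> pi" if "0 \<le> y" "y \<le> L" for y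
    using that f_inv_into_f[of y X "{0..pi}"] inv_into_into[of y X "{0..pi}"] image
    by (auto simp: \<theta>_def)
  have cont\<theta>: "continuous_on {0..L} \<theta>"
    unfolding image[symmetric] by (intro continuous_on_inv[OF contX]) (use \<theta>X in auto)
  have interior: "0 < \<theta> y \<and> \<theta> y < pi \<and> (\<theta> has_real_derivative sin (\<theta> y) powr (1 - a) / sqrt a) (at y)"
    if y: "0 < y" "y < L" for y
  proof -
    have ne: "\<theta> y \<noteq> 0" "\<theta> y \<noteq> pi"
      using X\<theta>(1)[of y] y X0 by (auto simp: L_def)
    then have \<theta>y: "0 < \<theta> y" "\<theta> y < pi"
      using X\<theta>(2,3)[of y] y by auto
    then have s: "0 < sin (\<theta> y)" by (rule sin_gt_zero)
    have "(\<theta> has_real_derivative inverse (sqrt a * sin (\<theta> y) powr (a - 1))) (at y)"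
    proof (rule DERIV_inverse_function[of X])
      show "(X has_real_derivative sqrt a * sin (\<theta> y) powr (a - 1)) (at (\<theta> y))"
        by (rule derX[OF \<theta>y])
      show "sqrt a * sin (\<theta> y) powr (a - 1) \<noteq> 0" using a s by simp
      show "X (\<theta> z) = z" if "0 < z" "z < L" for z using X\<theta>(1)[of z] that by simp
      show "isCont \<theta> y"
        using continuous_on_interior[OF cont\<theta>, of y] y by simp
    qed (use y in auto)
    moreover have "inverse (sqrt a * sin (\<theta> y) powr (a - 1)) = sin (\<theta> y) powr (1 - a) / sqrt a"
      using powr_minus[of "sin (\<theta> y)" "a - 1"] by (simp add: field_simps)
    ultimately show ?thesis using \<theta>y by simp
  qed
  have "\<theta> 0 = 0" "\<theta> L = pi" "\<theta> (X (pi / 2)) = pi / 2"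
    using \<theta>X[of 0] \<theta>X[of pi] \<theta>X[of "pi / 2"] X0 by (simp_all add: L_def)
  moreover have "0 < X (pi / 2)" "X (pi / 2) < L"
    using incr[of 0 "pi / 2"] incr[of "pi / 2" pi] X0 by (simp_all add: L_def)
  ultimately show ?thesis
    using cont\<theta> interior by blast
qed

lemma arccos_cos_has_derivative:
  assumes "sin z \<noteq> 0"
  shows "((\<lambda>z. arccos (cos z)) has_real_derivative sgn (sin z)) (at z)"
proof -
  have "(cos z)\<^sup>2 < 1"
    using assms by (simp add: cos_squared_eq)
  then have "\<bar>cos z\<bar> < 1" by (simp add: abs_square_less_1)
  then have "((\<lambda>z. arccos (cos z)) has_real_derivative inverse (- sqrt (1 - (cos z)\<^sup>2)) * (- sin z)) (at z)"
    by (intro DERIV_chain2[OF DERIV_arccos DERIV_cos]) auto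
  moreover have "inverse (- sqrt (1 - (cos z)\<^sup>2)) * (- sin z) = sgn (sin z)"
    using assms by (simp add: sin_squared_eq[symmetric] sgn_if divide_simps)
  ultimately show ?thesis by simp
qed

text \<open>
  The bump \<open>sin (\<theta> y) powr a\<close> on \<open>[0, L]\<close> is extended to the whole line by composing \<open>\<theta>\<close> with the
  triangle wave \<open>d\<close> of period \<open>2 * L\<close>, written as \<open>arccos\<close> of \<open>cos\<close> so that continuity is automatic. Away
  from the multiples of \<open>L\<close> the slope of \<open>d\<close> is locally constant and equal to 1 or -1, which does not
  affect the autonomous second-order equation; at the multiples of \<open>L\<close> the profile vanishes.
\<close>

lemma periodic_profile_exists:
  fixes p :: real
  assumes p: "0 < p"
  shows "\<exists>(v :: real \<Rightarrow> real) t T. continuous_on UNIV v \<and> (\<forall>s. 0 \<le> v s \<and> v s \<le> 1) \<and> v 0 = 0 \<and>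
    (\<forall>s. 0 < v s \<longrightarrow> (\<exists>w. (\<forall>\<^sub>F r in nhds s. (v has_real_derivative w r) (at r)) \<and>
                (w has_real_derivative - (v s powr p)) (at s))) \<and>
    0 < t \<and> 0 < T \<and> (\<forall>n::nat. v (t + n * T) = 1)"
proof -
  define a where "a = 2 / (p + 1)"
  have a: "0 < a" "a * p = 2 - a"
    using p by (simp_all add: a_def field_simps)
  obtain \<theta> L t where L: "0 < t" "t < L" and cont: "continuous_on {0..L} \<theta>"
    and ends: "\<theta> 0 = 0" "\<theta> L = pi" "\<theta> t = pi / 2"
    and int: "\<And>y. 0 < y \<Longrightarrow> y < L \<Longrightarrow> 0 < \<theta> y \<and> \<theta> y < pi \<and>
       (\<theta> has_real_derivative sin (\<theta> y) powr (1 - a) / sqrt a) (at y)"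
    using bump_angle_exists[OF a(1)] by auto
  have \<theta>_range: "0 \<le> \<theta> y \<and> \<theta> y \<le> pi" if "0 \<le> y" "y \<le> L" for y
    using that int[of y] ends by (cases "y = 0"; cases "y = L") auto
  define d where "d s = L / pi * arccos (cos (pi * s / L))" for s
  have d_range: "0 \<le> d s" "d s \<le> L" for s
    using L arccos_lbound[of "cos (pi * s / L)"] arccos_ubound[of "cos (pi * s / L)"]
    by (auto simp: d_def field_simps)
  define \<Theta> where "\<Theta> s = \<theta> (d s)" for s
  define v where "v s = sin (\<Theta> s) powr a" for s
  have contd: "continuous_on UNIV d"
    unfolding d_def using L by (intro continuous_intros) auto
  have cont\<Theta>: "continuous_on UNIV \<Theta>"
    unfolding \<Theta>_def by (rule continuous_on_compose2[OF cont contd]) (use d_range in auto)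
  have sin_nonneg: "0 \<le> sin (\<Theta> s)" for s
    unfolding \<Theta>_def using \<theta>_range d_range by (intro sin_ge_zero) auto
  have contv: "continuous_on UNIV v"
    unfolding v_def using a sin_nonneg cont\<Theta>
    by (intro continuous_on_powr' continuous_intros) auto
  have dd: "0 < d s \<and> d s < L \<and> (d has_real_derivative sgn (sin (pi * s / L))) (at s)"
    if ne: "sin (pi * s / L) \<noteq> 0" for s
  proof -
    have "(cos (pi * s / L))\<^sup>2 < 1"
      using ne by (simp add: cos_squared_eq)
    then have "\<bar>cos (pi * s / L)\<bar> < 1" by (simp add: abs_square_less_1)
    then have "0 < arccos (cos (pi * s / L)) \<and> arccos (cos (pi * s / L)) < pi"
      by (intro arccos_lt_bounded) auto
    then have "0 < d s" "d s < L" using L by (auto simp: d_def field_simps)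
    moreover have "((\<lambda>s. pi * s / L) has_real_derivative pi / L) (at s)"
      using L by (auto intro!: derivative_eq_intros)
    then have "(d has_real_derivative L / pi * (sgn (sin (pi * s / L)) * (pi / L))) (at s)"
      unfolding d_def by (intro DERIV_cmult DERIV_chain2[where f = "\<lambda>z. arccos (cos z)" and g = "\<lambda>s. pi * s / L", OF arccos_cos_has_derivative[OF ne]])
    ultimately show ?thesis using L by simp
  qed
  have d\<Theta>: "0 < sin (\<Theta> s) \<and>
      (\<Theta> has_real_derivative sin (\<Theta> s) powr (1 - a) / sqrt a * sgn (sin (pi * s / L))) (at s)"
    if ne: "sin (pi * s / L) \<noteq> 0" for s
  proof -
    have y: "0 < d s" "d s < L" and ds: "(d has_real_derivative sgn (sin (pi * s / L))) (at s)"
      using dd[OF ne] by auto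
    have "(\<theta> has_real_derivative sin (\<theta> (d s)) powr (1 - a) / sqrt a) (at (d s))"
      using int[OF y] by blast
    from DERIV_chain2[OF this ds] show ?thesis
      using int[OF y] sin_gt_zero[of "\<theta> (d s)"] by (simp add: \<Theta>_def[abs_def])
  qed
  have dv: "(v has_real_derivative sqrt a * cos (\<Theta> s) * sgn (sin (pi * s / L))) (at s)"
    if ne: "sin (pi * s / L) \<noteq> 0" for s
  proof -
    note \<Theta> = d\<Theta>[OF ne]
    have "(v has_real_derivative a * sin (\<Theta> s) powr (a - 1) *
        (cos (\<Theta> s) * (sin (\<Theta> s) powr (1 - a) / sqrt a * sgn (sin (pi * s / L))))) (at s)"
      unfolding v_def using \<Theta> by (auto intro!: derivative_eq_intros)
    moreover have "sin (\<Theta> s) powr (a - 1) * sin (\<Theta> s) powr (1 - a) = 1"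
      using \<Theta> by (simp flip: powr_add)
    moreover have "a * sin (\<Theta> s) powr (a - 1) * (cos (\<Theta> s) * (sin (\<Theta> s) powr (1 - a) / sqrt a * sgn (sin (pi * s / L))))
        = (a / sqrt a) * (sin (\<Theta> s) powr (a - 1) * sin (\<Theta> s) powr (1 - a)) * cos (\<Theta> s) * sgn (sin (pi * s / L))"
      by simp
    moreover have "a / sqrt a = sqrt a" using a by (simp add: real_div_sqrt)
    ultimately show ?thesis by simp
  qed
  have ode: "\<exists>w. (\<forall>\<^sub>F r in nhds s. (v has_real_derivative w r) (at r)) \<and>
                (w has_real_derivative - (v s powr p)) (at s)" if pos: "0 < v s" for s
  proof -
    have "\<Theta> s \<noteq> 0" "\<Theta> s \<noteq> pi" using pos by (auto simp: v_def)
    then have "d s \<noteq> 0" "d s \<noteq> L" using ends by (auto simp: \<Theta>_def)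
    then have "cos (pi * s / L) \<noteq> 1" "cos (pi * s / L) \<noteq> - 1" by (auto simp: d_def)
    then have ne: "sin (pi * s / L) \<noteq> 0"
      using sin_zero_abs_cos_one by fastforce
    \<comment> \<open>the slope of the triangle wave near \<open>s\<close>\<close>
    define \<sigma> where "\<sigma> = sgn (sin (pi * s / L))"
    have \<sigma>: "\<sigma> * \<sigma> = 1" using ne by (simp add: \<sigma>_def sgn_if)
    have "((\<lambda>r. \<sigma> * sin (pi * r / L)) \<longlongrightarrow> \<sigma> * sin (pi * s / L)) (nhds s)"
      using L by (intro tendsto_intros filterlim_ident) auto
    moreover have "0 < \<sigma> * sin (pi * s / L)"
      using ne by (simp add: \<sigma>_def sgn_if)
    ultimately have "\<forall>\<^sub>F r in nhds s. 0 < \<sigma> * sin (pi * r / L)"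
      by (rule order_tendstoD)
    then have "\<forall>\<^sub>F r in nhds s. (v has_real_derivative sqrt a * cos (\<Theta> r) * \<sigma>) (at r)"
    proof eventually_elim
      case (elim r)
      then have "sin (pi * r / L) \<noteq> 0" "sgn (sin (pi * r / L)) = \<sigma>"
        by (auto simp: \<sigma>_def sgn_if zero_less_mult_iff split: if_splits)
      with dv[of r] show ?case by simp
    qed
    moreover have "((\<lambda>r. sqrt a * cos (\<Theta> r) * \<sigma>) has_real_derivative - (v s powr p)) (at s)"
    proof -
      note \<Theta> = d\<Theta>[OF ne, folded \<sigma>_def]
      have "((\<lambda>r. sqrt a * cos (\<Theta> r) * \<sigma>) has_real_derivative
          sqrt a * (- sin (\<Theta> s) * (sin (\<Theta> s) powr (1 - a) / sqrt a * \<sigma>)) * \<sigma>) (at s)"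
        using \<Theta> by (auto intro!: derivative_eq_intros)
      moreover have "sqrt a * (- sin (\<Theta> s) * (sin (\<Theta> s) powr (1 - a) / sqrt a * \<sigma>)) * \<sigma>
          = - (sin (\<Theta> s) powr (1 - a) * sin (\<Theta> s)) * (\<sigma> * \<sigma>)"
        using a by simp
      moreover have "sin (\<Theta> s) powr (1 - a) * sin (\<Theta> s) = sin (\<Theta> s) powr (2 - a)"
        using \<Theta> powr_add[of "sin (\<Theta> s)" "1 - a" 1] by simp
      moreover have "sin (\<Theta> s) powr (2 - a) = v s powr p"
        by (simp add: v_def powr_powr a)
      ultimately show ?thesis using \<sigma> by simp
    qed
    ultimately show ?thesis
      by (intro exI[of _ "\<lambda>r. sqrt a * cos (\<Theta> r) * \<sigma>"] conjI)
  qed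
  have peak: "v (t + real n * (2 * L)) = 1" for n :: nat
  proof -
    have "pi * (t + real n * (2 * L)) / L = pi * t / L + 2 * real n * pi"
      using L by (simp add: field_simps)
    then have "cos (pi * (t + real n * (2 * L)) / L) = cos (pi * t / L)"
      by (simp add: cos_add sin_add)
    then have "d (t + real n * (2 * L)) = t"
      using L by (simp add: d_def arccos_cos field_simps)
    then show ?thesis by (simp add: v_def \<Theta>_def ends)
  qed
  have "v 0 = 0" by (simp add: v_def \<Theta>_def d_def ends)
  moreover have "0 \<le> v s \<and> v s \<le> 1" for s
    using a sin_nonneg[of s] by (simp add: v_def powr_le1)
  ultimately show ?thesis
    using contv ode L peak
    by (intro exI[of _ v] exI[of _ t] exI[of _ "2 * L"]) simp
qed

section \<open>The planar solution\<close>

lemma open_half_space: "open (half_space l)"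
  unfolding half_space_def by (rule open_halfspace_component_gt_cart)

lemma closure_half_space: "closure (half_space l) = {x :: real^'n. 0 \<le> x $ l}"
  by (simp add: half_space_def)

lemma frontier_half_space: "frontier (half_space l) = {x :: real^'n. x $ l = 0}"
proof -
  have "interior (half_space l) = half_space l"
    using open_half_space by (rule interior_open)
  then show ?thesis
    unfolding frontier_def closure_half_space by (auto simp: half_space_def)
qed

text \<open>
  Where \<open>v\<close> is positive, \<open>v\<close> is twice differentiable and touching yields an inequality between the
  Hessian of \<open>\<phi>\<close> and \<open>- v powr p\<close> times the projection to the normal direction.

  Where \<open>v\<close> vanishes, no smoothness of \<open>v\<close> is available. A function \<open>\<phi>\<close> touching from below is then
  dominated near the contact point by a constant on the hyperplane through that point, so its Hessian is nonpositive
  on that hyperplane and \<open>k < N\<close> makes \<open>P_minus k\<close> nonpositive. A function \<open>\<phi>\<close> touching from above has a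
  local minimum at the contact point, because \<open>v \<ge> 0\<close>, so its Hessian is nonnegative.
\<close>

lemma planar_viscosity_solution:
  fixes l :: "'n::finite" and v :: "real \<Rightarrow> real"
  assumes k: "0 < k" "k < CARD('n)"
    and cont: "continuous_on UNIV v" and nonneg: "\<And>s. 0 \<le> v s" and zero: "v 0 = 0"
    and ode: "\<And>s. 0 < v s \<Longrightarrow> \<exists>w. (\<forall>\<^sub>F r in nhds s. (v has_real_derivative w r) (at r)) \<and>
                (w has_real_derivative - (v s powr p)) (at s)"
  shows "nonneg_viscosity_solution l k p (\<lambda>x. v (x $ l))"
  unfolding nonneg_viscosity_solution_def
proof (intro conjI ballI allI impI)
  show "continuous_on (closure (half_space l)) (\<lambda>x. v (x $ l))"
    by (intro continuous_on_compose2[OF cont] continuous_intros) auto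
  show "0 \<le> v (x $ l)" for x :: "real^'n" by (rule nonneg)
  show "v (x $ l) = 0" if "x \<in> frontier (half_space l)" for x
    using that zero by (simp add: frontier_half_space)
next
  fix x :: "real^'n" and \<phi> G H
  assume x: "x \<in> half_space l" and C2: "C2_with (half_space l) \<phi> G H"
  note S = open_half_space x
  have sym: "transpose (H x) = H x"
    using C2 S by (intro hessian_symmetric[OF S]) (auto simp: C2_with_def)
  have along: "\<forall>\<^sub>F t in nhds 0. P (x + t *\<^sub>R h)" if "\<forall>\<^sub>F y in nhds x. P y" for P h
  proof -
    have "((\<lambda>t. x + t *\<^sub>R h) \<longlongrightarrow> x + 0 *\<^sub>R h) (nhds 0)"
      by (intro tendsto_intros filterlim_ident)
    then show ?thesis
      using that eventually_compose_filterlim[of P "nhds x" "\<lambda>t. x + t *\<^sub>R h" "nhds 0"] by simp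
  qed
  have profile: "\<exists>\<psi>'. (\<forall>\<^sub>F t in nhds 0. ((\<lambda>t. v (x $ l + t * h)) has_real_derivative \<psi>' t) (at t)) \<and>
      (\<psi>' has_real_derivative - (v (x $ l) powr p) * h\<^sup>2) (at 0)" if pos: "0 < v (x $ l)" for h
  proof -
    obtain w where w: "\<forall>\<^sub>F r in nhds (x $ l). (v has_real_derivative w r) (at r)"
        "(w has_real_derivative - (v (x $ l) powr p)) (at (x $ l))"
      using ode[OF pos] by blast
    have "((\<lambda>t. x $ l + t * h) \<longlongrightarrow> x $ l + 0 * h) (nhds 0)"
      by (intro tendsto_intros filterlim_ident)
    then have "\<forall>\<^sub>F t in nhds 0. (v has_real_derivative w (x $ l + t * h)) (at (x $ l + t * h))"
      using eventually_compose_filterlim[OF w(1)] by simp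
    then have "\<forall>\<^sub>F t in nhds 0. ((\<lambda>t. v (x $ l + t * h)) has_real_derivative w (x $ l + t * h) * h) (at t)"
      by eventually_elim (rule DERIV_chain2, assumption, auto intro!: derivative_eq_intros)
    moreover have "((\<lambda>t. w (x $ l + t * h)) has_real_derivative - (v (x $ l) powr p) * h) (at 0)"
      by (rule DERIV_chain2[where f = w]) (use w(2) in \<open>auto intro!: derivative_eq_intros\<close>)
    then have "((\<lambda>t. w (x $ l + t * h) * h) has_real_derivative - (v (x $ l) powr p) * h\<^sup>2) (at 0)"
      by (auto intro!: derivative_eq_intros simp: power2_eq_square)
    ultimately show ?thesis
      by (intro exI[of _ "\<lambda>t. w (x $ l + t * h) * h"] conjI)
  qed
  {
    assume "has_local_min (\<lambda>x. v (x $ l) - \<phi> x) x"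
    then have min: "\<forall>\<^sub>F t in nhds 0. v (x $ l) - \<phi> x \<le> v (x $ l + t * h $ l) - \<phi> (x + t *\<^sub>R h)" for h
      using along[of "\<lambda>y. v (x $ l) - \<phi> x \<le> v (y $ l) - \<phi> y" h] by (simp add: has_local_min_def)
    show "P_minus k (H x) + v (x $ l) powr p \<le> 0"
    proof (cases "v (x $ l) = 0")
      case True
      \<comment> \<open>along the hyperplane \<open>v (x $ l)\<close> is constant, so the line test applies with \<open>\<psi> = 0\<close>\<close>
      have "P_minus k (H x) \<le> 0"
      proof (rule P_minus_nonpos_of_hyperplane[where l = l, OF sym k(2)])
        fix h :: "real^'n" assume "h $ l = 0"
        then show "h \<bullet> (H x *v h) \<le> 0"
          using hessian_bounds_on_line(1)[OF C2 S, of "\<lambda>_. 0" "\<lambda>_. 0" 0 h] min[of h] by simp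
      qed
      then show ?thesis using True by simp
    next
      case False
      then have pos: "0 < v (x $ l)" using nonneg[of "x $ l"] by simp
      have le: "h \<bullet> (H x *v h) \<le> - (v (x $ l) powr p) * (h $ l)\<^sup>2" for h
      proof -
        obtain \<psi>' where "\<forall>\<^sub>F t in nhds 0. ((\<lambda>t. v (x $ l + t * h $ l)) has_real_derivative \<psi>' t) (at t)"
          "(\<psi>' has_real_derivative - (v (x $ l) powr p) * (h $ l)\<^sup>2) (at 0)"
          using profile[OF pos, of "h $ l"] by blast
        from hessian_bounds_on_line(1)[OF C2 S this, of h] show ?thesis using min[of h] by simp
      qed
      have "P_minus k (H x) \<le> - (v (x $ l) powr p)"
      proof (rule P_minus_le_of_hyperplane[where l = l, OF sym k])
        show "h \<bullet> (H x *v h) \<le> 0" if "h $ l = 0" for h using le[of h] that by simp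
        show "axis l 1 \<bullet> (H x *v axis l 1) \<le> - (v (x $ l) powr p)" using le[of "axis l 1"] by simp
      qed
      then show ?thesis by simp
    qed
  next
    assume "has_local_max (\<lambda>x. v (x $ l) - \<phi> x) x"
    then have max: "\<forall>\<^sub>F t in nhds 0. v (x $ l + t * h $ l) - \<phi> (x + t *\<^sub>R h) \<le> v (x $ l) - \<phi> x" for h
      using along[of "\<lambda>y. v (y $ l) - \<phi> y \<le> v (x $ l) - \<phi> x" h] by (simp add: has_local_max_def)
    have "- (v (x $ l) powr p) * (h $ l)\<^sup>2 \<le> h \<bullet> (H x *v h)" for h
    proof (cases "v (x $ l) = 0")
      case True
      have "\<forall>\<^sub>F t in nhds 0. 0 - \<phi> (x + t *\<^sub>R h) \<le> 0 - \<phi> x"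
        using max[of h]
      proof eventually_elim
        case (elim t)
        then show ?case using True nonneg[of "x $ l + t * h $ l"] by simp
      qed
      then show ?thesis
        using hessian_bounds_on_line(2)[OF C2 S, of "\<lambda>_. 0" "\<lambda>_. 0" 0 h] True by simp
    next
      case False
      then have pos: "0 < v (x $ l)" using nonneg[of "x $ l"] by simp
      obtain \<psi>' where "\<forall>\<^sub>F t in nhds 0. ((\<lambda>t. v (x $ l + t * h $ l)) has_real_derivative \<psi>' t) (at t)"
        "(\<psi>' has_real_derivative - (v (x $ l) powr p) * (h $ l)\<^sup>2) (at 0)"
        using profile[OF pos, of "h $ l"] by blast
      from hessian_bounds_on_line(2)[OF C2 S this, of h] show ?thesis using max[of h] by simp
    qed
    then have "- (v (x $ l) powr p) \<le> P_minus k (H x)"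
      using k by (intro le_P_minus_of_rank_one_lower_bound[where l = l, OF sym]) auto
    then show "0 \<le> P_minus k (H x) + v (x $ l) powr p" by simp
  }
qed

theorem theorem1p4:
  fixes l :: "'n::finite" and k :: nat and p :: real
  assumes "0 < k" and "k < CARD('n)" and "0 < p"
  shows "\<exists>u :: real ^ 'n \<Rightarrow> real.
           nonneg_viscosity_solution l k p u \<and>
           bounded (u ` closure (half_space l)) \<and>
           (\<exists>c>0. \<exists>t :: nat \<Rightarrow> real.
              (\<forall>n. 0 < t n) \<and> filterlim t at_top sequentially \<and>
              (\<forall>n. \<forall>x. x $ l = t n \<longrightarrow> c \<le> u x))"
proof -
  obtain v :: "real \<Rightarrow> real" and t T where cont: "continuous_on UNIV v"
    and v: "\<forall>s. 0 \<le> v s \<and> v s \<le> 1" "v 0 = 0"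
    and ode: "\<forall>s. 0 < v s \<longrightarrow> (\<exists>w. (\<forall>\<^sub>F r in nhds s. (v has_real_derivative w r) (at r)) \<and>
                (w has_real_derivative - (v s powr p)) (at s))"
    and T: "0 < t" "0 < T" and peak: "\<forall>n::nat. v (t + n * T) = 1"
    using periodic_profile_exists[OF assms(3)] by (elim exE conjE)
  let ?t = "\<lambda>n::nat. t + n * T"
  have "filterlim ?t at_top sequentially"
    by (intro filterlim_tendsto_add_at_top[OF tendsto_const]
        filterlim_at_top_mult_tendsto_pos[OF tendsto_const T(2) filterlim_real_sequentially])
  moreover have "0 < ?t n" for n using T by (simp add: add_pos_nonneg)
  moreover have "bounded ((\<lambda>x. v (x $ l)) ` closure (half_space l))"
    using v by (intro boundedI[of _ 1]) auto
  moreover have "nonneg_viscosity_solution l k p (\<lambda>x. v (x $ l))"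
    by (rule planar_viscosity_solution[OF assms(1,2) cont]) (use v ode in auto)
  ultimately show ?thesis
    using peak
    by (intro exI[of _ "\<lambda>x. v (x $ l)"] conjI exI[of _ 1] exI[of _ ?t]) auto
qed

end
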